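(* Let $\alpha\in(-1,1)$ and $q\in(-1,1)$. Then the following identities hold as operators on the space of polynomials $\mathbb{C}[z]$ (the linear span of the vectors $z^n$, $n\ge0$). (1) $[a^-,a^+]_q=M_{\alpha,q}$, $\quad [a^-,M_{\alpha,q}]_{q^2}=(1-q^2)\,a^-$, $\quad [M_{\alpha,q},a^+]_{q^2}=(1-q^2)\,a^+$. (2) $M_{\alpha,q}=(1+\alpha)I-\alpha(1-q^2)\,Z D_{q^2}$. (3) In particular, if $\alpha=q$, then $[a^-,a^+]_{q^2}=(1+q)I$.
   Context: Convention: $0^0=1$. For operators $A,B$ and a scalar $s$, $[A,B]_s:=AB-sBA$. $I$ is the identity. $Z$ is multiplication by $z$: $(Zf)(z)=zf(z)$. $N$ is the number operator, $N z^n=n z^n$, and $q^{2N}$ is the operator with $q^{2N}z^n=q^{2n}z^n$. For a parameter $p\neq1$, the Jackson derivative is $(D_pf)(z)=\frac{f(z)-f(pz)}{(1-p)z}$ for $z\ne0$ and $(D_pf)(0)=f'(0)$. The $\alpha$-deformed Jackson derivative is $$D_{\alpha,q}=\begin{cases} D_q+\alpha q^{2N}D_{1/q}, & q\neq0,\\ D_0+\alpha\,\frac{d}{dz}\big|_{0}, & q=0,\end{cases}$$ where $\frac{d}{dz}\big|_0$ maps $f$ to the constant $f'(0)$. (Thus $D_{\alpha,q}z^n=(1+\alpha q^{n-1})[n]_qz^{n-1}$ for $n\ge1$, with $[n]_q=1+q+\cdots+q^{n-1}$, and $D_{\alpha,q}1=0$.) The one-mode $(\alpha,q)$-creation and annihilation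 operators are $a^+:=Z$ and $a^-:=D_{\alpha,q}$, and $M_{\alpha,q}:=I+\alpha q^{2N}$. *)

theory Defs
  imports "HOL-Analysis.Analysis" "HOL-Computational_Algebra.Polynomial"
begin

text \<open>
  The space of polynomials is the type \<^typ>\<open>complex poly\<close>, and an operator is a
  function on it; \<open>monom 1 n\<close> is the vector \<open>z^n\<close>. All powers use \<open>0^0 = 1\<close>.
\<close>

type_synonym poly_op = "complex poly \<Rightarrow> complex poly"

definition q_commutator :: "poly_op \<Rightarrow> poly_op \<Rightarrow> real \<Rightarrow> poly_op" where
  "q_commutator A B s = (\<lambda>f. A (B f) - smult (of_real s) (B (A f)))"

definition mult_Z :: poly_op where
  "mult_Z f = [:0, 1:] * f"

text \<open>\<open>q^(2N)\<close>: the linear operator with \<open>z^n \<mapsto> q^(2n) z^n\<close>.\<close>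

definition q_pow_2N :: "real \<Rightarrow> poly_op" where
  "q_pow_2N q f = (\<Sum>n\<le>degree f. monom (of_real (q ^ (2 * n)) * coeff f n) n)"

lemma coeff_q_pow_2N: "coeff (q_pow_2N q f) n = of_real (q ^ (2 * n)) * coeff f n"
proof (cases "n \<le> degree f")
  case True
  then show ?thesis
    by (simp add: q_pow_2N_def coeff_sum)
next
  case False
  then show ?thesis
    by (auto simp: q_pow_2N_def coeff_sum coeff_eq_0 intro!: sum.neutral)
qed

lemma q_pow_2N_add: "q_pow_2N q (f + g) = q_pow_2N q f + q_pow_2N q g"
  by (simp add: poly_eq_iff coeff_q_pow_2N algebra_simps)

lemma q_pow_2N_smult: "q_pow_2N q (smult c f) = smult c (q_pow_2N q f)"
  by (simp add: poly_eq_iff coeff_q_pow_2N)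

lemma q_pow_2N_monom: "q_pow_2N q (monom 1 n) = monom (of_real (q ^ (2 * n))) n"
  by (simp add: poly_eq_iff coeff_q_pow_2N)

definition jackson_fun :: "real \<Rightarrow> (complex \<Rightarrow> complex) \<Rightarrow> complex \<Rightarrow> complex" where
  "jackson_fun p f z =
     (if z = 0 then deriv f 0 else (f z - f (of_real p * z)) / ((1 - of_real p) * z))"

text \<open>
  For \<open>p \<noteq> 1\<close> the Jackson derivative of a polynomial function is again a polynomial
  function (\<open>poly_jackson_deriv\<close> below), so it induces an operator on polynomials.
\<close>

definition jackson_deriv :: "real \<Rightarrow> poly_op" where
  "jackson_deriv p f = (THE g. \<forall>z. poly g z = jackson_fun p (poly f) z)"

lemma ex1_jackson_deriv:
  assumes "p \<noteq> 1"
  shows "\<exists>!g. \<forall>z. poly g z = jackson_fun p (poly f) z"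
proof (rule ex_ex1I)
  obtain a h where f: "f = pCons a h"
    by (cases f)
  define g where
    "g = smult (1 / (1 - of_real p)) (h - smult (of_real p) (pcompose h [:0, of_real p:]))"
  have p: "1 - complex_of_real p \<noteq> 0"
    using assms by (metis eq_iff_diff_eq_0 of_real_eq_1_iff)
  have "deriv (poly f) 0 = poly (pderiv f) 0"
    by (intro DERIV_imp_deriv poly_DERIV)
  then have d: "deriv (poly f) 0 = poly h 0"
    by (simp add: f pderiv_pCons)
  have "poly g z = jackson_fun p (poly f) z" for z
    using p by (simp add: jackson_fun_def d g_def poly_pcompose) (simp add: f field_simps)
  then show "\<exists>g. \<forall>z. poly g z = jackson_fun p (poly f) z"
    by blast
next
  fix g g' :: "complex poly"
  assume "\<forall>z. poly g z = jackson_fun p (poly f) z" "\<forall>z. poly g' z = jackson_fun p (poly f) z"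
  then show "g = g'"
    by (simp add: poly_eq_poly_eq_iff [symmetric] fun_eq_iff)
qed

lemma poly_jackson_deriv:
  "p \<noteq> 1 \<Longrightarrow> poly (jackson_deriv p f) z = jackson_fun p (poly f) z"
  unfolding jackson_deriv_def using theI' [OF ex1_jackson_deriv] by blast

definition D_alpha :: "real \<Rightarrow> real \<Rightarrow> poly_op" where
  "D_alpha \<alpha> q f =
     (if q \<noteq> 0
      then jackson_deriv q f + smult (of_real \<alpha>) (q_pow_2N q (jackson_deriv (1 / q) f))
      else jackson_deriv 0 f + smult (of_real \<alpha>) [:poly (pderiv f) 0:])"

definition a_plus :: poly_op where
  "a_plus = mult_Z"

definition a_minus :: "real \<Rightarrow> real \<Rightarrow> poly_op" where
  "a_minus \<alpha> q = D_alpha \<alpha> q"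

definition M_op :: "real \<Rightarrow> real \<Rightarrow> poly_op" where
  "M_op \<alpha> q f = f + smult (of_real \<alpha>) (q_pow_2N q f)"

end

theory Submission
  imports Defs
begin

text \<open>
  All operators here are diagonal or weighted shifts in the basis \<open>z^n\<close>: \<open>Z\<close> raises the
  degree with weight 1, \<open>M\<close> scales \<open>z^n\<close> by \<open>1 + \<alpha> q^(2n)\<close>, and \<open>D\<close> lowers the degree with
  weight \<open>(1 + \<alpha> q^(n - 1)) [n]\<close>, where \<open>[n] = 1 + q + \<dots> + q^(n - 1)\<close>. The last formula
  is lemma \<open>coeff_D_alpha\<close>; for \<open>q \<noteq> 0\<close> it comes from the reflection \<open>q^n [n + 1]_(1/q) = [n + 1]_q\<close>, which
  turns the factor \<open>q^(2n)\<close> in front of \<open>D_(1/q)\<close> into \<open>q^n\<close>. Comparing coefficients, each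
  identity becomes an identity between weights. The relations between \<open>M\<close> and the
  ladder operators hold because moving one degree multiplies \<open>\<alpha> q^(2n)\<close> by \<open>q^2\<close>, so that
  this part cancels in the commutator and the constant part contributes \<open>1 - q^2\<close>. The
  remaining ones rest on the two recurrences
  \<open>[n + 1] = 1 + q [n] = [n] + q^n\<close> and on \<open>(1 - q) [n] = 1 - q^n\<close>.
\<close>

definition q_int :: "real \<Rightarrow> nat \<Rightarrow> real" where
  "q_int p n = (\<Sum>k<n. p ^ k)"

lemma q_int_0 [simp]: "q_int p 0 = 0"
  by (simp add: q_int_def)

lemma q_int_Suc: "q_int p (Suc n) = q_int p n + p ^ n"
  by (simp add: q_int_def)

lemma q_int_Suc_shift: "q_int p (Suc n) = 1 + p * q_int p n"
  by (simp only: q_int_def sum.lessThan_Suc_shift) (simp add: sum_distrib_left)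

lemma one_minus_times_q_int: "(1 - p) * q_int p n = 1 - p ^ n"
  by (simp add: q_int_def one_diff_power_eq)

lemma q_int_at_zero: "q_int 0 (Suc n) = 1"
  by (simp add: q_int_Suc_shift)

lemma q_int_inverse:
  assumes "q \<noteq> 0"
  shows "q ^ n * q_int (1 / q) (Suc n) = q_int q (Suc n)"
proof (induction n)
  case 0
  show ?case
    by (simp add: q_int_def)
next
  case (Suc n)
  have "q ^ Suc n * q_int (1 / q) (Suc (Suc n))
      = q * (q ^ n * q_int (1 / q) (Suc n)) + q ^ Suc n * (1 / q) ^ Suc n"
    by (subst q_int_Suc) (simp add: algebra_simps)
  also have "\<dots> = q * q_int q (Suc n) + 1"
    using assms Suc.IH by (simp add: power_one_over)
  finally show ?case
    by (simp add: q_int_Suc_shift [of q "Suc n"])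
qed

text \<open>
  Clearing the denominator in the difference quotient gives the polynomial identity
  \<open>(1 - p) z D_p f = f(z) - f(p z)\<close>, which also holds at \<open>z = 0\<close>. Its coefficients
  determine those of \<open>D_p f\<close> because \<open>p \<noteq> 1\<close>.
\<close>

lemma coeff_jackson_deriv:
  assumes "p \<noteq> 1"
  shows "coeff (jackson_deriv p f) n = of_real (q_int p (Suc n)) * coeff f (Suc n)"
proof -
  have p: "1 - complex_of_real p \<noteq> 0"
    using assms by (metis eq_iff_diff_eq_0 of_real_eq_1_iff)
  have "smult (1 - of_real p) (pCons 0 (jackson_deriv p f)) = f - pcompose f [:0, of_real p:]"
    (is "?l = ?r")
  proof -
    have "poly ?l z = poly ?r z" for z
      using p by (simp add: poly_jackson_deriv [OF assms] jackson_fun_def poly_pcompose mult.commute)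
    then show ?thesis
      by (simp add: poly_eq_poly_eq_iff [symmetric] fun_eq_iff)
  qed
  then have "coeff ?l (Suc n) = coeff ?r (Suc n)"
    by simp
  then have "(1 - of_real p) * coeff (jackson_deriv p f) n
      = (1 - of_real p ^ Suc n) * coeff f (Suc n)"
    by (simp add: coeff_pcompose_linear algebra_simps)
  also have "1 - of_real p ^ Suc n = (1 - complex_of_real p) * of_real (q_int p (Suc n))"
    using arg_cong [OF one_minus_times_q_int [of p "Suc n"], of complex_of_real] by simp
  finally show ?thesis
    using p by (simp add: mult.assoc)
qed

lemma coeff_D_alpha:
  assumes "q \<noteq> 1"
  shows "coeff (D_alpha \<alpha> q f) n
    = of_real ((1 + \<alpha> * q ^ n) * q_int q (Suc n)) * coeff f (Suc n)"
proof (cases "q = 0")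
  case True
  \<comment> \<open>The weights \<open>1 + \<alpha> 0^n\<close> see \<open>\<alpha>\<close> only at \<open>n = 0\<close>, by \<open>0^0 = 1\<close>; this is the
    contribution of \<open>f'(0)\<close>.\<close>
  then show ?thesis
    by (cases n)
      (simp_all add: D_alpha_def coeff_jackson_deriv q_int_at_zero poly_0_coeff_0 coeff_pderiv
        algebra_simps)
next
  case False
  have "q ^ (2 * n) * q_int (1 / q) (Suc n) = q ^ n * q_int q (Suc n)"
    by (simp add: mult_2 power_add mult.assoc q_int_inverse [OF False])
  then have "complex_of_real q ^ (2 * n) * of_real (q_int (1 / q) (Suc n))
      = of_real q ^ n * of_real (q_int q (Suc n))"
    by (metis of_real_mult of_real_power)
  moreover have "1 / q \<noteq> 1"
    using assms by (simp add: field_simps)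
  ultimately show ?thesis
    using assms False
    by (simp add: D_alpha_def coeff_jackson_deriv coeff_q_pow_2N ring_distribs
        mult.assoc [symmetric])
qed

lemma coeff_M_op: "coeff (M_op \<alpha> q f) n = of_real (1 + \<alpha> * q ^ (2 * n)) * coeff f n"
  by (simp add: M_op_def coeff_q_pow_2N algebra_simps)

lemma coeff_mult_Z: "coeff (mult_Z f) n = (case n of 0 \<Rightarrow> 0 | Suc m \<Rightarrow> coeff f m)"
  by (simp add: mult_Z_def coeff_pCons)

text \<open>
  Operators that agree up to real weights on the coefficients of the argument are compared
  through the weights; this moves the computation from complex polynomials to real numbers.
\<close>

lemma poly_op_eq_by_weights:
  fixes A B :: poly_op
  assumes "\<And>f n. coeff (A f) n = of_real (a n) * coeff f (r n)"
    and "\<And>f n. coeff (B f) n = of_real (b n) * coeff f (r n)"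
    and "\<And>n. a n = b n"
  shows "A = B"
  by (simp add: fun_eq_iff poly_eq_iff assms)

text \<open>
  The product \<open>Z D\<close> is diagonal with eigenvalue \<open>(1 + \<alpha> q^(n - 1)) [n]\<close> on \<open>z^n\<close>. The
  truncated exponent at \<open>n = 0\<close> is harmless since \<open>[0] = 0\<close>.
\<close>

lemma coeff_q_commutator_minus_plus:
  assumes "q \<noteq> 1"
  shows "coeff (q_commutator (a_minus \<alpha> q) a_plus s f) n
    = of_real ((1 + \<alpha> * q ^ n) * q_int q (Suc n)
        - s * ((1 + \<alpha> * q ^ (n - 1)) * q_int q n)) * coeff f n"
  using assms
  by (cases n)
    (simp_all add: q_commutator_def a_minus_def a_plus_def coeff_D_alpha coeff_mult_Z
      left_diff_distrib mult.assoc)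

lemma q_commutator_minus_plus:
  assumes "q \<noteq> 1"
  shows "q_commutator (a_minus \<alpha> q) a_plus q = M_op \<alpha> q"
proof (rule poly_op_eq_by_weights
    [OF coeff_q_commutator_minus_plus [OF assms] coeff_M_op])
  fix n
  show "(1 + \<alpha> * q ^ n) * q_int q (Suc n) - q * ((1 + \<alpha> * q ^ (n - 1)) * q_int q n)
      = 1 + \<alpha> * q ^ (2 * n)"
  proof -
    have "q * ((1 + \<alpha> * q ^ (n - 1)) * q_int q n) = (q + \<alpha> * q ^ n) * q_int q n"
      by (cases n) (simp_all add: algebra_simps)
    moreover have "(1 + \<alpha> * q ^ n) * q_int q (Suc n)
        = (1 + q * q_int q n) + \<alpha> * q ^ n * (q_int q n + q ^ n)"
      by (metis (no_types) q_int_Suc q_int_Suc_shift distrib_right mult_1)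
    ultimately show ?thesis
      by (simp only: mult_2 power_add) (simp add: ring_distribs mult_ac)
  qed
qed

lemma q_commutator_minus_M:
  assumes "q \<noteq> 1"
  shows "q_commutator (a_minus \<alpha> q) (M_op \<alpha> q) (q\<^sup>2)
    = (\<lambda>f. smult (of_real (1 - q\<^sup>2)) (a_minus \<alpha> q f))"
  using assms
  by (simp add: fun_eq_iff poly_eq_iff q_commutator_def a_minus_def coeff_D_alpha coeff_M_op
      algebra_simps power2_eq_square)

lemma q_commutator_M_plus:
  "q_commutator (M_op \<alpha> q) a_plus (q\<^sup>2) = (\<lambda>f. smult (of_real (1 - q\<^sup>2)) (a_plus f))"
  by (simp add: fun_eq_iff poly_eq_iff q_commutator_def a_plus_def coeff_M_op coeff_mult_Z
      algebra_simps power2_eq_square split: nat.split)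

lemma M_op_eq_jackson:
  assumes "q\<^sup>2 \<noteq> 1"
  shows "M_op \<alpha> q
    = (\<lambda>f. smult (of_real (1 + \<alpha>)) f
          - smult (of_real (\<alpha> * (1 - q\<^sup>2))) (mult_Z (jackson_deriv (q\<^sup>2) f)))"
    (is "_ = ?R")
proof (rule poly_op_eq_by_weights [OF coeff_M_op])
  show "coeff (?R f) n
      = of_real ((1 + \<alpha>) - \<alpha> * (1 - q\<^sup>2) * q_int (q\<^sup>2) n) * coeff f n" for f n
    using assms
    by (cases n)
      (simp_all add: coeff_mult_Z coeff_jackson_deriv left_diff_distrib mult.assoc)
  show "1 + \<alpha> * q ^ (2 * n) = (1 + \<alpha>) - \<alpha> * (1 - q\<^sup>2) * q_int (q\<^sup>2) n" for n
    by (simp only: mult.assoc one_minus_times_q_int power_mult) (simp add: right_diff_distrib)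
qed

text \<open>
  For \<open>\<alpha> = q\<close> the weight of \<open>D\<close> on \<open>z^n\<close> is \<open>(1 + q^n) [n]\<close>, which after multiplication by
  \<open>1 - q\<close> becomes \<open>1 - q^(2n)\<close>. So if \<open>q^2 \<noteq> 1\<close>, then \<open>D\<close> is \<open>1 + q\<close> times the Jackson derivative
  with parameter \<open>q^2\<close>, whose commutator with \<open>Z\<close> at \<open>q^2\<close> is the identity.
\<close>

lemma q_commutator_minus_plus_diagonal:
  assumes "q \<noteq> 1"
  shows "q_commutator (a_minus q q) a_plus (q\<^sup>2) = (\<lambda>f. smult (of_real (1 + q)) f)"
proof (rule poly_op_eq_by_weights
    [OF coeff_q_commutator_minus_plus [OF assms] coeff_smult])
  fix n
  have weight: "(1 - q) * ((1 + q ^ m) * q_int q m) = 1 - q ^ m * q ^ m" for m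
  proof -
    have "(1 - q) * ((1 + q ^ m) * q_int q m) = (1 + q ^ m) * ((1 - q) * q_int q m)"
      by (simp only: mult.left_commute)
    also have "\<dots> = 1 - q ^ m * q ^ m"
      by (simp only: one_minus_times_q_int) (simp add: algebra_simps)
    finally show ?thesis .
  qed
  have "(1 + q * q ^ (n - 1)) * q_int q n = (1 + q ^ n) * q_int q n"
    by (cases n) simp_all
  then have "(1 - q) * ((1 + q * q ^ n) * q_int q (Suc n)
        - q\<^sup>2 * ((1 + q * q ^ (n - 1)) * q_int q n))
      = (1 - q) * ((1 + q ^ Suc n) * q_int q (Suc n))
        - q\<^sup>2 * ((1 - q) * ((1 + q ^ n) * q_int q n))"
    by (simp add: right_diff_distrib mult.left_commute)
  also have "\<dots> = (1 - q) * (1 + q)"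
    unfolding weight by (simp add: algebra_simps power2_eq_square)
  finally show "(1 + q * q ^ n) * q_int q (Suc n)
      - q\<^sup>2 * ((1 + q * q ^ (n - 1)) * q_int q n) = 1 + q"
    using assms by simp
qed

theorem theorem4p3:
  fixes \<alpha> q :: real
  assumes "\<alpha> \<in> {-1<..<1}" and "q \<in> {-1<..<1}"
  shows "q_commutator (a_minus \<alpha> q) a_plus q = M_op \<alpha> q
    \<and> q_commutator (a_minus \<alpha> q) (M_op \<alpha> q) (q\<^sup>2)
        = (\<lambda>f. smult (of_real (1 - q\<^sup>2)) (a_minus \<alpha> q f))
    \<and> q_commutator (M_op \<alpha> q) a_plus (q\<^sup>2)
        = (\<lambda>f. smult (of_real (1 - q\<^sup>2)) (a_plus f))
    \<and> M_op \<alpha> q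
        = (\<lambda>f. smult (of_real (1 + \<alpha>)) f
              - smult (of_real (\<alpha> * (1 - q\<^sup>2))) (mult_Z (jackson_deriv (q\<^sup>2) f)))
    \<and> (\<alpha> = q \<longrightarrow>
        q_commutator (a_minus \<alpha> q) a_plus (q\<^sup>2) = (\<lambda>f. smult (of_real (1 + q)) f))"
proof -
  have "q \<noteq> 1" "q\<^sup>2 \<noteq> 1"
    using assms(2) by (auto simp: power2_eq_1_iff)
  then show ?thesis
    using q_commutator_minus_plus q_commutator_minus_M q_commutator_M_plus M_op_eq_jackson
      q_commutator_minus_plus_diagonal
    by blast
qed

end
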